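(* Let $u^0\in\mathbb{M}_h$ satisfy $\|u^0\|_\infty\le\beta$, let $\kappa\ge\|f'\|_{C[-\beta,\beta]}$ and $0<\tau\le\frac{h^2}{2\varepsilon^2}$. Then the solution generated from $u^0$ by the ESS1 method with time step $\tau$ satisfies $$E_h(u^{n+1})\le E_h(u^n),\qquad 0\le n\le N_t-1.$$
   Context: Problem: the two-dimensional Allen-Cahn equation $u_t=\varepsilon^2\Delta u+f(u)$ on $\Omega=(0,2\pi)^2$ with periodic boundary conditions, $t\in(0,T]$, $T>0$, $\varepsilon>0$. Assumptions on $f$: $\beta>0$ is a constant, $f$ is a real-valued function on an interval containing $[-\beta,\beta]$, continuously differentiable on $[-\beta,\beta]$, with $f(\beta)\le 0\le f(-\beta)$. $F$ is a bulk potential with $F'=-f$. Write $\|f'\|_{C[-\beta,\beta]}=\max_{\xi\in[-\beta,\beta]}|f'(\xi)|$. Grid: $M$ is a positive integer, $h=2\pi/M$. $\mathbb{M}_h$ is the space of real grid functions $v=(v_{ij})_{0\le i,j\le M-1}$ (indices extended periodically mod $M$), identified with $M\times M$ real matrices, with $\|v\|_\infty=\max_{i,j}|v_{ij}|$, $\langle v,w\rangle=h^2\sum_{i,j=0}^{M-1}v_{ij}w_{ij}$, $\|v\|=\sqrt{\langle v,v\rangle}$. The discrete gradient is $\nabla_hv_{ij}=\big(\frac{v_{i+1,j}-v_{ij}}{h},\frac{v_{i,j+1}-v_{ij}}{h}\big)^{\mathrm T}$, and for pairs $\bm v=(v^1,v^2)$ of grid functions $\|\bm v\|^2=\|v^1\|^2+\|v^2\|^2$.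 The discrete energy is $E_h(v)=\frac{\varepsilon^2}{2}\|\nabla_hv\|^2+\langle F(v),1\rangle$, with $F$ acting entrywise. $\tau>0$ is the time step, $t_n=n\tau$, $N_t=\lfloor T/\tau\rfloor$. Operators: $D_a$ is the $M\times M$ matrix (indices $0,\dots,M-1$) equal to $h^{-2}$ times the matrix with $-1$ on the diagonal, $1$ at positions $(i,i+1)$ for $0\le i\le M-2$, $1$ at position $(0,M-1)$, and zeros elsewhere (contributions at coinciding positions are added when $M\le 2$). $D_b=D_a^{\mathrm T}$. For $v\in\mathbb{M}_h$ set $\varDelta_a v=D_av+vD_a^{\mathrm T}$ and $\varDelta_b v=D_bv+vD_b^{\mathrm T}$. ESS1 method with stabilization parameter $\kappa$: $f$ acts entrywise, and $u^{n+1}$ is determined from $u^n$ by $$\frac{u^{n+1}-u^n}{\tau}=\varepsilon^2(\varDelta_au^n+\varDelta_bu^{n+1})+f(u^n)-\kappa(u^{n+1}-u^n).$$ *)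

theory Defs
  imports "HOL-Analysis.Analysis" "Jordan_Normal_Form.Matrix"
begin

text \<open>
  Grid functions on the periodic \<open>M \<times> M\<close> grid are real \<open>M \<times> M\<close> matrices with indices
  \<open>0, \<dots>, M - 1\<close>; pairs of grid functions serve as discrete vector fields.
\<close>

abbreviation grid_functions :: "nat \<Rightarrow> real mat set" where
  "grid_functions M \<equiv> carrier_mat M M"

definition mesh_size :: "nat \<Rightarrow> real" where
  "mesh_size M = 2 * pi / real M"

definition grid_sup_norm :: "nat \<Rightarrow> real mat \<Rightarrow> real" where
  "grid_sup_norm M v = Max ((\<lambda>(i, j). \<bar>v $$ (i, j)\<bar>) ` ({..<M} \<times> {..<M}))"

definition grid_inner :: "nat \<Rightarrow> real mat \<Rightarrow> real mat \<Rightarrow> real" where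
  "grid_inner M v w = (mesh_size M)\<^sup>2 * (\<Sum>i<M. \<Sum>j<M. v $$ (i, j) * w $$ (i, j))"

definition grid_norm :: "nat \<Rightarrow> real mat \<Rightarrow> real" where
  "grid_norm M v = sqrt (grid_inner M v v)"

definition grid_pair_norm :: "nat \<Rightarrow> real mat \<times> real mat \<Rightarrow> real" where
  "grid_pair_norm M V = sqrt ((grid_norm M (fst V))\<^sup>2 + (grid_norm M (snd V))\<^sup>2)"

definition grid_gradient :: "nat \<Rightarrow> real mat \<Rightarrow> real mat \<times> real mat" where
  "grid_gradient M v =
     (mat M M (\<lambda>(i, j). (v $$ ((i + 1) mod M, j) - v $$ (i, j)) / mesh_size M),
      mat M M (\<lambda>(i, j). (v $$ (i, (j + 1) mod M) - v $$ (i, j)) / mesh_size M))"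

text \<open>
  The constant grid function \<open>1\<close>; it is not the identity matrix \<open>1\<^sub>m M\<close>.
\<close>

definition grid_one :: "nat \<Rightarrow> real mat" where
  "grid_one M = mat M M (\<lambda>_. 1)"

definition discrete_energy :: "nat \<Rightarrow> real \<Rightarrow> (real \<Rightarrow> real) \<Rightarrow> real mat \<Rightarrow> real" where
  "discrete_energy M \<epsilon> F v =
     \<epsilon>\<^sup>2 / 2 * (grid_pair_norm M (grid_gradient M v))\<^sup>2 + grid_inner M (map_mat F v) (grid_one M)"

text \<open>
  The corner entry of \<open>D\<^sub>a\<close> sits at \<open>(0, M - 1)\<close>, so for \<open>M \<ge> 2\<close> the matrix is upper triangular
  and \<open>D\<^sub>a + D\<^sub>a\<^sup>T\<close> is the periodic second difference matrix.
  The three contributions are added, which matters when positions coincide (\<open>M \<le> 2\<close>).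
\<close>

definition D_a :: "nat \<Rightarrow> real mat" where
  "D_a M = (1 / (mesh_size M)\<^sup>2) \<cdot>\<^sub>m
     mat M M (\<lambda>(i, j). (if j = i then - 1 else 0)
                      + (if j = i + 1 then 1 else 0)
                      + (if i = 0 \<and> j = M - 1 then 1 else 0))"

definition D_b :: "nat \<Rightarrow> real mat" where
  "D_b M = transpose_mat (D_a M)"

definition Delta_a :: "nat \<Rightarrow> real mat \<Rightarrow> real mat" where
  "Delta_a M v = D_a M * v + v * transpose_mat (D_a M)"

definition Delta_b :: "nat \<Rightarrow> real mat \<Rightarrow> real mat" where
  "Delta_b M v = D_b M * v + v * transpose_mat (D_b M)"

text \<open>
  One step of the method, from \<open>v\<close> to \<open>w\<close>.
  It is semi-implicit: \<open>w\<close> also occurs on the right-hand side.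
\<close>

definition ESS1_step ::
  "nat \<Rightarrow> real \<Rightarrow> (real \<Rightarrow> real) \<Rightarrow> real \<Rightarrow> real \<Rightarrow> real mat \<Rightarrow> real mat \<Rightarrow> bool" where
  "ESS1_step M \<epsilon> f \<kappa> \<tau> v w \<longleftrightarrow>
     (1 / \<tau>) \<cdot>\<^sub>m (w - v) =
       \<epsilon>\<^sup>2 \<cdot>\<^sub>m (Delta_a M v + Delta_b M w) + map_mat f v - \<kappa> \<cdot>\<^sub>m (w - v)"

definition ESS1_solution ::
  "nat \<Rightarrow> real \<Rightarrow> (real \<Rightarrow> real) \<Rightarrow> real \<Rightarrow> real \<Rightarrow> nat \<Rightarrow> (nat \<Rightarrow> real mat) \<Rightarrow> bool" where
  "ESS1_solution M \<epsilon> f \<kappa> \<tau> N u \<longleftrightarrow>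
     (\<forall>n\<le>N. u n \<in> grid_functions M) \<and>
     (\<forall>n<N. ESS1_step M \<epsilon> f \<kappa> \<tau> (u n) (u (n + 1)))"

text \<open>
  Continuous differentiability on the closed interval \<open>[a, b]\<close> with derivative \<open>f'\<close>,
  which is one-sided at the end points.
\<close>

definition C1_on_interval :: "real \<Rightarrow> real \<Rightarrow> (real \<Rightarrow> real) \<Rightarrow> (real \<Rightarrow> real) \<Rightarrow> bool" where
  "C1_on_interval a b f f' \<longleftrightarrow>
     (\<forall>x\<in>{a..b}. (f has_real_derivative f' x) (at x within {a..b})) \<and> continuous_on {a..b} f'"

text \<open>
  The maximum norm on \<open>C[a, b]\<close>, written as a supremum because \<^const>\<open>Max\<close> is meaningful for
  finite sets only; for continuous \<open>g\<close> and \<open>a \<le> b\<close> the supremum is attained.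
\<close>

definition C_norm :: "real \<Rightarrow> real \<Rightarrow> (real \<Rightarrow> real) \<Rightarrow> real" where
  "C_norm a b g = (SUP x\<in>{a..b}. \<bar>g x\<bar>)"

end

theory Submission
  imports Defs
begin

text \<open>
  Two facts combine: the scheme preserves the bound \<open>\<beta>\<close> on the grid function, and within this bound
  testing the scheme with the increment of one step shows that the energy decays.

  For the energy, the essential point is that the two one-sided operators are adjoint,
  \<open>\<langle>\<Delta>\<^sub>a v, w\<rangle> = \<langle>v, \<Delta>\<^sub>b w\<rangle>\<close> (\<open>Delta_adjoint\<close>), and that each of them has half the quadratic form of the
  periodic Laplacian, \<open>\<parallel>\<nabla>\<^sub>h v\<parallel>\<^sup>2 = - 2 \<langle>\<Delta>\<^sub>a v, v\<rangle>\<close> (\<open>grid_gradient_norm_sq\<close>). Although one operator is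
  applied to the old and the other to the new grid function, the cross terms therefore cancel:
  \<open>\<langle>\<Delta>\<^sub>a v + \<Delta>\<^sub>b w, w - v\<rangle> = \<langle>\<Delta>\<^sub>b w, w\<rangle> - \<langle>\<Delta>\<^sub>a v, v\<rangle> = (\<parallel>\<nabla>\<^sub>h v\<parallel>\<^sup>2 - \<parallel>\<nabla>\<^sub>h w\<parallel>\<^sup>2) / 2\<close>.
  Testing the scheme with \<open>w - v\<close> thus gives the exact change of the gradient energy,
  \<open>\<langle>f(v), w - v\<rangle> - (1/\<tau> + \<kappa>) \<parallel>w - v\<parallel>\<^sup>2\<close>. The potential energy changes by at most
  \<open>- \<langle>f(v), w - v\<rangle> + (\<kappa>/2) \<parallel>w - v\<parallel>\<^sup>2\<close>, because \<open>F(x) - \<kappa> x\<^sup>2 / 2\<close> is concave on \<open>[-\<beta>, \<beta>]\<close>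
  (\<open>potential_increment_le\<close>); this is where the bound on the grid functions enters. The sum of both is
  nonpositive (\<open>ESS1_step_energy\<close>).

  The maximum bound (\<open>ESS1_step_maximum_principle\<close>) uses the triangular structure of the operators.
  For \<open>M \<ge> 2\<close> the first and the last row of \<open>D\<^sub>a\<close> and of \<open>D\<^sub>b\<close> do not sum to zero, so neither operator
  satisfies a maximum principle alone. Together, however, they use every one of the four periodic
  neighbours of a grid point exactly once, either at the old or at the new time level, and the new
  values that occur belong to points that come earlier in the order of increasing \<open>i + j\<close>. With \<open>e = \<epsilon>\<^sup>2 / h\<^sup>2\<close> the scheme reads
  \<open>(1/\<tau> + \<kappa> + 2e) w\<^sub>i\<^sub>j = (1/\<tau> + \<kappa> - 2e) v\<^sub>i\<^sub>j + f(v\<^sub>i\<^sub>j) + e (sum of the four neighbours)\<close>,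
  and the condition \<open>2e \<le> 1/\<tau>\<close> makes the coefficient of \<open>v\<^sub>i\<^sub>j\<close> at least \<open>\<kappa>\<close>, so that the first two
  terms on the right are bounded by \<open>(1/\<tau> + \<kappa> - 2e) \<beta>\<close>.
\<close>

section \<open>The stabilized reaction term\<close>

lemma C1_abs_derivative_le_C_norm:
  assumes "C1_on_interval a b f f'" and "x \<in> {a..b}"
  shows "\<bar>f' x\<bar> \<le> C_norm a b f'"
proof -
  have "continuous_on {a..b} (\<lambda>x. \<bar>f' x\<bar>)"
    using assms(1) by (auto simp: C1_on_interval_def intro: continuous_intros)
  then have "bdd_above ((\<lambda>x. \<bar>f' x\<bar>) ` {a..b})"
    by (intro bounded_imp_bdd_above compact_imp_bounded compact_continuous_image) auto
  then show ?thesis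
    unfolding C_norm_def using assms(2) by (rule cSUP_upper[rotated])
qed

lemma stabilized_reaction_mono:
  fixes f f' :: "real \<Rightarrow> real"
  assumes "C1_on_interval a b f f'" and "C_norm a b f' \<le> \<kappa>"
    and "x \<in> {a..b}" and "y \<in> {a..b}" and "x \<le> y"
  shows "f x + \<kappa> * x \<le> f y + \<kappa> * y"
proof (cases "x = y")
  case False
  then have "x < y" using assms(5) by simp
  have "\<exists>z\<in>{x<..<y}. f y - f x = (y - x) * f' z"
  proof -
    have "(f has_derivative (*) (f' z)) (at z within {x..y})" if "x \<le> z" "z \<le> y" for z
    proof -
      have "(f has_real_derivative f' z) (at z within {a..b})"
        using assms that by (auto simp: C1_on_interval_def)
      then have "(f has_real_derivative f' z) (at z within {x..y})"
        by (rule DERIV_subset) (use assms in auto)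
      then show ?thesis by (simp add: has_field_derivative_def)
    qed
    from mvt_simple[OF \<open>x < y\<close> this] show ?thesis by (auto simp: mult.commute)
  qed
  then obtain z where z: "z \<in> {x<..<y}" "f y - f x = (y - x) * f' z" by blast
  have "\<bar>f' z\<bar> \<le> \<kappa>"
    using C1_abs_derivative_le_C_norm[OF assms(1), of z] z(1) assms by auto
  then have "0 \<le> (y - x) * (f' z + \<kappa>)" using \<open>x < y\<close> by (intro mult_nonneg_nonneg) auto
  then show ?thesis using z(2) by (simp add: algebra_simps)
qed simp

text \<open>
  The function \<open>F(t) - \<kappa> t\<^sup>2 / 2\<close> has the nonincreasing derivative \<open>- (f t + \<kappa> t)\<close>, hence lies
  below its tangents.
\<close>

lemma potential_increment_le:
  fixes f f' F :: "real \<Rightarrow> real"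
  assumes "C1_on_interval a b f f'" and "C_norm a b f' \<le> \<kappa>"
    and F: "\<And>x. x \<in> {a..b} \<Longrightarrow> (F has_real_derivative - f x) (at x within {a..b})"
    and x: "x \<in> {a..b}" and y: "y \<in> {a..b}"
  shows "F y - F x \<le> - f x * (y - x) + \<kappa> / 2 * (y - x)\<^sup>2"
proof -
  let ?G = "\<lambda>t. F t - \<kappa> / 2 * t\<^sup>2"
  let ?g = "\<lambda>t. f t + \<kappa> * t"
  have mvt: "\<exists>z\<in>{p<..<q}. ?G q - ?G p = - ?g z * (q - p)"
    if pq: "p < q" "p \<in> {a..b}" "q \<in> {a..b}" for p q
  proof -
    have "(?G has_derivative (*) (- ?g z)) (at z within {p..q})" if "p \<le> z" "z \<le> q" for z
    proof -
      have "(F has_real_derivative - f z) (at z within {p..q})"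
        by (rule DERIV_subset[OF F]) (use pq that in auto)
      then have "(?G has_real_derivative - ?g z) (at z within {p..q})"
        by (auto intro!: derivative_eq_intros)
      then show ?thesis by (simp only: has_field_derivative_def)
    qed
    from mvt_simple[OF pq(1) this] show ?thesis by blast
  qed
  have "?G y - ?G x \<le> - ?g x * (y - x)"
  proof (cases x y rule: linorder_cases)
    case less
    from mvt[OF less x y] obtain z where z: "z \<in> {x<..<y}" "?G y - ?G x = - ?g z * (y - x)"
      by blast
    have "?g x \<le> ?g z"
      by (rule stabilized_reaction_mono[OF assms(1,2)]) (use z x y in auto)
    then show ?thesis unfolding z(2) using less by (intro mult_right_mono) auto
  next
    case greater
    from mvt[OF greater y x] obtain z where z: "z \<in> {y<..<x}" "?G x - ?G y = - ?g z * (x - y)"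
      by blast
    have "?g z \<le> ?g x"
      by (rule stabilized_reaction_mono[OF assms(1,2)]) (use z x y in auto)
    then have "?g z * (x - y) \<le> ?g x * (x - y)" using greater by (intro mult_right_mono) auto
    then show ?thesis using z(2) by (simp add: algebra_simps)
  qed simp
  then show ?thesis by (simp add: algebra_simps power2_eq_square)
qed

text \<open>
  By monotonicity \<open>f x + \<kappa> x\<close> lies between its values at \<open>\<plusminus>\<beta>\<close>, which the signs of \<open>f\<close> at the end
  points confine to \<open>[- \<kappa> \<beta>, \<kappa> \<beta>]\<close>; the remainder \<open>(c - \<kappa>) x\<close> is increasing as well.
\<close>

lemma stabilized_reaction_bound:
  fixes f f' :: "real \<Rightarrow> real"
  assumes "C1_on_interval (- \<beta>) \<beta> f f'" and "C_norm (- \<beta>) \<beta> f' \<le> \<kappa>"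
    and "f \<beta> \<le> 0" and "0 \<le> f (- \<beta>)" and "\<kappa> \<le> c" and "\<bar>x\<bar> \<le> \<beta>"
  shows "\<bar>c * x + f x\<bar> \<le> c * \<beta>"
proof -
  have "f x + \<kappa> * x \<le> f \<beta> + \<kappa> * \<beta>" and "f (- \<beta>) + \<kappa> * (- \<beta>) \<le> f x + \<kappa> * x"
    using stabilized_reaction_mono[OF assms(1,2), of x \<beta>]
      stabilized_reaction_mono[OF assms(1,2), of "- \<beta>" x] assms(6) by auto
  moreover have "(c - \<kappa>) * x \<le> (c - \<kappa>) * \<beta>" and "(c - \<kappa>) * (- \<beta>) \<le> (c - \<kappa>) * x"
    using mult_left_mono[of x \<beta> "c - \<kappa>"] mult_left_mono[of "- \<beta>" x "c - \<kappa>"] assms(5,6) by auto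
  ultimately show ?thesis using assms(3,4) by (simp add: algebra_simps)
qed

section \<open>One-sided differences and the discrete gradient\<close>

text \<open>
  Up to the factor \<open>h\<^sup>2\<close>, \<open>fwd\<close> and \<open>bwd\<close> are the actions of \<open>D\<^sub>a\<close> and \<open>D\<^sub>b\<close> on a vector. The operators on
  grid functions apply them along columns and along rows, which reduces summation by parts and the
  counting of neighbours to one dimension.
\<close>

definition fwd :: "nat \<Rightarrow> (nat \<Rightarrow> real) \<Rightarrow> nat \<Rightarrow> real" where
  "fwd M x i = (if i + 1 < M then x (i + 1) else 0) + (if i = 0 then x (M - 1) else 0) - x i"

definition bwd :: "nat \<Rightarrow> (nat \<Rightarrow> real) \<Rightarrow> nat \<Rightarrow> real" where
  "bwd M x i = (if 0 < i then x (i - 1) else 0) + (if i = M - 1 then x 0 else 0) - x i"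

lemma D_a_carrier [simp]: "D_a M \<in> carrier_mat M M" "dim_row (D_a M) = M" "dim_col (D_a M) = M"
  by (auto simp: D_a_def)

lemma D_a_row_sum:
  assumes "i < M"
  shows "(\<Sum>k<M. D_a M $$ (i, k) * x k) = fwd M x i / (mesh_size M)\<^sup>2"
proof -
  let ?c = "1 / (mesh_size M)\<^sup>2"
  have "(\<Sum>k<M. D_a M $$ (i, k) * x k)
      = (\<Sum>k<M. ?c * ((if k = i then - x k else 0) + (if k = i + 1 then x k else 0)
            + (if k = M - 1 then (if i = 0 then x k else 0) else 0)))"
    using assms by (intro sum.cong) (auto simp: D_a_def algebra_simps)
  also have "\<dots> = ?c * fwd M x i"
    unfolding sum_distrib_left[symmetric] sum.distrib using assms by (auto simp: fwd_def)
  finally show ?thesis by simp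
qed

lemma D_a_col_sum:
  assumes "i < M"
  shows "(\<Sum>k<M. D_a M $$ (k, i) * x k) = bwd M x i / (mesh_size M)\<^sup>2"
proof -
  let ?c = "1 / (mesh_size M)\<^sup>2"
  have "(\<Sum>k<M. D_a M $$ (k, i) * x k)
      = (\<Sum>k<M. ?c * ((if k = i then - x k else 0)
            + (if k = i - 1 then (if 0 < i then x k else 0) else 0)
            + (if k = 0 then (if i = M - 1 then x k else 0) else 0)))"
    using assms by (intro sum.cong) (auto simp: D_a_def algebra_simps)
  also have "\<dots> = ?c * bwd M x i"
    unfolding sum_distrib_left[symmetric] sum.distrib using assms by (auto simp: bwd_def)
  finally show ?thesis by simp
qed

lemma mesh_size_pos: "M > 0 \<Longrightarrow> mesh_size M > 0"
  by (simp add: mesh_size_def)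

text \<open>This restates \<open>D\<^sub>b = D\<^sub>a\<^sup>T\<close>: the two row formulas come from the rows and columns of one matrix.\<close>

lemma fwd_bwd_adjoint:
  "(\<Sum>i<M. fwd M x i * y i) = (\<Sum>i<M. x i * bwd M y i)"
proof (cases "M = 0")
  case False
  let ?h = "(mesh_size M)\<^sup>2"
  have h: "?h \<noteq> 0" using mesh_size_pos[of M] False by simp
  have "(\<Sum>i<M. fwd M x i / ?h * y i) = (\<Sum>i<M. \<Sum>k<M. D_a M $$ (i, k) * x k * y i)"
    by (simp add: D_a_row_sum[symmetric] sum_distrib_right)
  also have "\<dots> = (\<Sum>k<M. x k * (bwd M y k / ?h))"
    by (subst sum.swap) (simp add: D_a_col_sum[symmetric] sum_distrib_left mult_ac)
  finally have "(\<Sum>i<M. fwd M x i * y i) / ?h = (\<Sum>i<M. x i * bwd M y i) / ?h"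
    by (simp add: sum_divide_distrib)
  then show ?thesis using h by simp
qed simp

text \<open>
  After expanding the square, both square terms have the same sum by cyclic invariance. The mixed
  products \<open>x\<^sub>i x\<^sub>i\<^sub>+\<^sub>1\<close>, one for each edge of the cycle, are those produced by \<open>fwd\<close>: it attaches the edge
  between \<open>M - 1\<close> and \<open>0\<close> to the point \<open>0\<close> and every other edge to its left end point.
\<close>

lemma sum_cyclic_difference_squares:
  assumes "M > 0"
  shows "(\<Sum>i<M. (x ((i + 1) mod M) - x i)\<^sup>2) = - 2 * (\<Sum>i<M. fwd M x i * x i)"
proof -
  obtain m where M: "M = Suc m" using assms gr0_implies_Suc by blast
  have cyc: "(\<Sum>i<M. g (x ((i + 1) mod M)) (x i)) = (\<Sum>i<m. g (x (Suc i)) (x i)) + g (x 0) (x m)"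
    for g :: "real \<Rightarrow> real \<Rightarrow> real"
    by (simp add: M)
  have shift: "(\<Sum>i<M. (x ((i + 1) mod M))\<^sup>2) = (\<Sum>i<M. (x i)\<^sup>2)"
    using cyc[of "\<lambda>a _. a\<^sup>2"] by (simp add: M sum.lessThan_Suc_shift del: sum.lessThan_Suc)
  have "(\<Sum>i<M. fwd M x i * x i)
      = (\<Sum>i<M. if i < m then x (Suc i) * x i else 0) + (\<Sum>i<M. if i = 0 then x m * x i else 0)
        - (\<Sum>i<M. (x i)\<^sup>2)"
    unfolding sum.distrib[symmetric] sum_subtractf[symmetric]
    by (intro sum.cong) (auto simp: fwd_def M algebra_simps power2_eq_square)
  also have "(\<Sum>i<M. if i = 0 then x m * x i else 0) = x m * x 0"
    by (simp add: M)
  also have "(\<Sum>i<M. if i < m then x (Suc i) * x i else 0) = (\<Sum>i<m. x (Suc i) * x i)"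
    by (simp add: M)
  finally have fw: "(\<Sum>i<M. fwd M x i * x i)
      = (\<Sum>i<M. x ((i + 1) mod M) * x i) - (\<Sum>i<M. (x i)\<^sup>2)"
    using cyc[of "(*)"] by (simp add: mult.commute)
  have "(\<Sum>i<M. (x ((i + 1) mod M) - x i)\<^sup>2)
      = (\<Sum>i<M. (x ((i + 1) mod M))\<^sup>2) + (\<Sum>i<M. (x i)\<^sup>2) - 2 * (\<Sum>i<M. x ((i + 1) mod M) * x i)"
    unfolding sum.distrib[symmetric] sum_subtractf[symmetric] sum_distrib_left
    by (intro sum.cong) (auto simp: power2_diff)
  then show ?thesis unfolding shift fw by simp
qed

lemma Delta_a_index:
  assumes "v \<in> grid_functions M" "i < M" "j < M"
  shows "Delta_a M v $$ (i, j)
    = (fwd M (\<lambda>k. v $$ (k, j)) i + fwd M (\<lambda>k. v $$ (i, k)) j) / (mesh_size M)\<^sup>2"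
proof -
  have "Delta_a M v $$ (i, j)
      = (\<Sum>k<M. D_a M $$ (i, k) * v $$ (k, j)) + (\<Sum>k<M. D_a M $$ (j, k) * v $$ (i, k))"
    using assms unfolding Delta_a_def
    by (simp add: scalar_prod_def atLeast0LessThan mult.commute)
  then show ?thesis by (simp add: D_a_row_sum assms add_divide_distrib)
qed

lemma Delta_b_index:
  assumes "v \<in> grid_functions M" "i < M" "j < M"
  shows "Delta_b M v $$ (i, j)
    = (bwd M (\<lambda>k. v $$ (k, j)) i + bwd M (\<lambda>k. v $$ (i, k)) j) / (mesh_size M)\<^sup>2"
proof -
  have "Delta_b M v $$ (i, j)
      = (\<Sum>k<M. D_a M $$ (k, i) * v $$ (k, j)) + (\<Sum>k<M. D_a M $$ (k, j) * v $$ (i, k))"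
    using assms unfolding Delta_b_def D_b_def
    by (simp add: scalar_prod_def atLeast0LessThan mult.commute)
  then show ?thesis by (simp add: D_a_col_sum assms add_divide_distrib)
qed

lemma Delta_carrier:
  assumes "v \<in> grid_functions M"
  shows "Delta_a M v \<in> grid_functions M" "Delta_b M v \<in> grid_functions M"
  using assms by (auto simp: Delta_a_def Delta_b_def D_b_def)

lemma Delta_adjoint:
  assumes "v \<in> grid_functions M" "w \<in> grid_functions M"
  shows "grid_inner M (Delta_a M v) w = grid_inner M v (Delta_b M w)"
proof -
  have "(\<Sum>i<M. \<Sum>j<M. fwd M (\<lambda>k. v $$ (k, j)) i * w $$ (i, j))
      = (\<Sum>i<M. \<Sum>j<M. v $$ (i, j) * bwd M (\<lambda>k. w $$ (k, j)) i)"
    by (subst (1 2) sum.swap) (simp add: fwd_bwd_adjoint)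
  moreover have "(\<Sum>i<M. \<Sum>j<M. fwd M (\<lambda>k. v $$ (i, k)) j * w $$ (i, j))
      = (\<Sum>i<M. \<Sum>j<M. v $$ (i, j) * bwd M (\<lambda>k. w $$ (i, k)) j)"
    by (simp add: fwd_bwd_adjoint)
  ultimately show ?thesis
    by (simp add: grid_inner_def Delta_a_index Delta_b_index assms ring_distribs sum.distrib
        add_divide_distrib flip: sum_divide_distrib)
qed

lemma grid_inner_self_nonneg: "0 \<le> grid_inner M v v"
  by (simp add: grid_inner_def sum_nonneg)

lemma grid_inner_commute: "grid_inner M v w = grid_inner M w v"
  by (simp add: grid_inner_def mult.commute)

lemma grid_gradient_norm_sq:
  assumes "M > 0" and "v \<in> grid_functions M"
  shows "(grid_pair_norm M (grid_gradient M v))\<^sup>2 = - 2 * grid_inner M (Delta_a M v) v"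
proof -
  let ?h = "mesh_size M"
  have h: "?h > 0" using assms mesh_size_pos by simp
  have "(grid_pair_norm M (grid_gradient M v))\<^sup>2
      = (\<Sum>j<M. \<Sum>i<M. (v $$ ((i + 1) mod M, j) - v $$ (i, j))\<^sup>2)
        + (\<Sum>i<M. \<Sum>j<M. (v $$ (i, (j + 1) mod M) - v $$ (i, j))\<^sup>2)"
    using h by (subst (1) sum.swap)
      (simp add: grid_pair_norm_def grid_norm_def grid_inner_self_nonneg,
       simp add: grid_gradient_def grid_inner_def power2_eq_square flip: sum_divide_distrib)
  also have "\<dots> = - 2 * ((\<Sum>j<M. \<Sum>i<M. fwd M (\<lambda>k. v $$ (k, j)) i * v $$ (i, j))
        + (\<Sum>i<M. \<Sum>j<M. fwd M (\<lambda>k. v $$ (i, k)) j * v $$ (i, j)))"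
    by (simp add: sum_cyclic_difference_squares[OF assms(1), of "\<lambda>k. v $$ (k, _)", simplified]
        sum_cyclic_difference_squares[OF assms(1), of "\<lambda>k. v $$ (_, k)", simplified]
        sum_distrib_left sum_negf distrib_left)
  also have "\<dots> = - 2 * grid_inner M (Delta_a M v) v"
    using h by (subst (1) sum.swap)
      (simp add: grid_inner_def Delta_a_index assms ring_distribs sum.distrib
        add_divide_distrib flip: sum_divide_distrib)
  finally show ?thesis .
qed

section \<open>The maximum principle\<close>

lemma ESS1_step_index:
  assumes "ESS1_step M \<epsilon> f \<kappa> \<tau> v w" "v \<in> grid_functions M" "w \<in> grid_functions M" "i < M" "j < M"
  shows "(1 / \<tau> + \<kappa>) * (w $$ (i, j) - v $$ (i, j))
    = \<epsilon>\<^sup>2 * (Delta_a M v $$ (i, j) + Delta_b M w $$ (i, j)) + f (v $$ (i, j))"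
proof -
  note car = Delta_carrier(1)[OF assms(2)] Delta_carrier(2)[OF assms(3)]
  have "((1 / \<tau>) \<cdot>\<^sub>m (w - v)) $$ (i, j)
      = (\<epsilon>\<^sup>2 \<cdot>\<^sub>m (Delta_a M v + Delta_b M w) + map_mat f v - \<kappa> \<cdot>\<^sub>m (w - v)) $$ (i, j)"
    using assms(1) by (simp add: ESS1_step_def)
  then show ?thesis using assms(2-) car by (simp add: algebra_simps)
qed

text \<open>
  Adding \<open>x i\<close> and \<open>y i\<close> removes the diagonal terms. What remains is one value for each of the two
  cyclic neighbours of \<open>i\<close>, of \<open>x\<close> for a larger and of \<open>y\<close> for a smaller index. For \<open>M = 1\<close> this fails:
  the point is its own neighbour, and \<open>bwd\<close> refers to \<open>y i\<close> itself.
\<close>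

lemma neighbour_sum_bound:
  assumes "2 \<le> M" "i < M" and "\<And>k. k < M \<Longrightarrow> \<bar>x k\<bar> \<le> \<beta>" and "\<And>k. k < i \<Longrightarrow> \<bar>y k\<bar> \<le> \<beta>"
  shows "\<bar>(fwd M x i + x i) + (bwd M y i + y i)\<bar> \<le> 2 * \<beta>"
proof -
  have "\<bar>fwd M x i + x i\<bar> \<le> (if i = M - 1 then 0 else \<beta>) + (if i = 0 then \<beta> else 0)"
    using assms(3)[of "i + 1"] assms(3)[of "M - 1"] assms(1,2) by (auto simp: fwd_def)
  moreover have "\<bar>bwd M y i + y i\<bar> \<le> (if i = 0 then 0 else \<beta>) + (if i = M - 1 then \<beta> else 0)"
  proof -
    have "\<bar>y (i - 1)\<bar> \<le> \<beta>" and "\<bar>y 0\<bar> \<le> \<beta>" if "0 < i"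
      using assms(4) that by simp_all
    then have "0 < i \<Longrightarrow> \<bar>y (i - 1)\<bar> + \<bar>y 0\<bar> \<le> 2 * \<beta>" by fastforce
    with \<open>0 < i \<Longrightarrow> \<bar>y (i - 1)\<bar> \<le> \<beta>\<close> assms(1) show ?thesis
      using abs_triangle_ineq[of "y (i - 1)" "y 0"]
      by (cases "i = 0"; cases "i = M - 1") (simp_all add: bwd_def)
  qed
  ultimately show ?thesis by (auto split: if_splits)
qed

text \<open>
  The new value at \<open>(i, j)\<close> depends on new values in the same column at smaller row index and in the same
  row at smaller column index (if \<open>M \<ge> 2\<close>), so the bound propagates by induction on \<open>i + j\<close>. The weights
  of the old value (with the reaction term) and of the four neighbours add up to
  \<open>(1/\<tau> + \<kappa> - 2e) + 4e = 1/\<tau> + \<kappa> + 2e\<close>, the coefficient of the new value.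
\<close>

lemma ESS1_step_maximum_principle:
  assumes M: "M > 0" and "\<epsilon> > 0" and \<tau>: "0 < \<tau>" "\<tau> \<le> (mesh_size M)\<^sup>2 / (2 * \<epsilon>\<^sup>2)"
    and f: "C1_on_interval (- \<beta>) \<beta> f f'" "C_norm (- \<beta>) \<beta> f' \<le> \<kappa>" "f \<beta> \<le> 0" "0 \<le> f (- \<beta>)"
    and step: "ESS1_step M \<epsilon> f \<kappa> \<tau> v w" "v \<in> grid_functions M" "w \<in> grid_functions M"
    and v: "\<And>i j. i < M \<Longrightarrow> j < M \<Longrightarrow> \<bar>v $$ (i, j)\<bar> \<le> \<beta>"
  shows "i < M \<Longrightarrow> j < M \<Longrightarrow> \<bar>w $$ (i, j)\<bar> \<le> \<beta>"
proof (induction "i + j" arbitrary: i j rule: less_induct)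
  case less
  define e where "e = \<epsilon>\<^sup>2 / (mesh_size M)\<^sup>2"
  have h: "mesh_size M > 0" using M by (rule mesh_size_pos)
  have e: "e > 0" using h \<open>\<epsilon> > 0\<close> by (simp add: e_def)
  have "2 * e \<le> 1 / \<tau>"
    using \<tau> h \<open>\<epsilon> > 0\<close> by (simp add: e_def field_simps)
  have "0 \<le> \<beta>" using v[OF M M] by linarith
  have "0 \<le> \<kappa>"
    using C1_abs_derivative_le_C_norm[OF f(1), of 0] f(2) \<open>0 \<le> \<beta>\<close> by auto
  let ?v = "v $$ (i, j)" and ?w = "w $$ (i, j)" and ?A = "1 / \<tau> + \<kappa>"
  let ?N1 = "(fwd M (\<lambda>k. v $$ (k, j)) i + ?v) + (bwd M (\<lambda>k. w $$ (k, j)) i + ?w)"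
  let ?N2 = "(fwd M (\<lambda>k. v $$ (i, k)) j + ?v) + (bwd M (\<lambda>k. w $$ (i, k)) j + ?w)"
  have eq: "?A * (?w - ?v) = e * (?N1 + ?N2 - 2 * ?v - 2 * ?w) + f ?v"
    unfolding ESS1_step_index[OF step less.prems] Delta_a_index[OF step(2) less.prems]
      Delta_b_index[OF step(3) less.prems] e_def
    by (simp add: algebra_simps add_divide_distrib)
  show ?case
  \<comment> \<open>On the grid with a single point both operators vanish, and only the reaction term acts.\<close>
  proof (cases "M = 1")
    case True
    then have "?A * ?w = ?A * ?v + f ?v"
      using eq less.prems by (simp add: fwd_def bwd_def algebra_simps)
    moreover have "\<bar>?A * ?v + f ?v\<bar> \<le> ?A * \<beta>"
      using \<tau>(1) v less.prems by (intro stabilized_reaction_bound[OF f]) auto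
    ultimately have "\<bar>?A * ?w\<bar> \<le> ?A * \<beta>" by (simp only:)
    moreover have "?A > 0" using \<tau>(1) \<open>0 \<le> \<kappa>\<close> by (simp add: add_pos_nonneg)
    ultimately show ?thesis
      by (simp only: abs_mult abs_of_pos mult_le_cancel_left_pos)
  next
    case False
    with M have "2 \<le> M" by simp
    have "\<bar>?N1\<bar> \<le> 2 * \<beta>"
      using less \<open>2 \<le> M\<close> v by (intro neighbour_sum_bound) auto
    moreover have "\<bar>?N2\<bar> \<le> 2 * \<beta>"
      using less \<open>2 \<le> M\<close> v by (intro neighbour_sum_bound) auto
    ultimately have "\<bar>?N1 + ?N2\<bar> \<le> 4 * \<beta>" by linarith
    then have N: "\<bar>e * (?N1 + ?N2)\<bar> \<le> e * (4 * \<beta>)"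
      using e by (simp only: abs_mult) (intro mult_mono, auto)
    have r: "\<bar>(?A - 2 * e) * ?v + f ?v\<bar> \<le> (?A - 2 * e) * \<beta>"
      using \<open>2 * e \<le> 1 / \<tau>\<close> v less.prems by (intro stabilized_reaction_bound[OF f]) auto
    have pos: "?A + 2 * e > 0" using \<tau>(1) e \<open>0 \<le> \<kappa>\<close> by (simp add: add_pos_nonneg)
    have "(?A + 2 * e) * ?w = ((?A - 2 * e) * ?v + f ?v) + e * (?N1 + ?N2)"
      using eq by (simp add: algebra_simps)
    then have "\<bar>(?A + 2 * e) * ?w\<bar> \<le> (?A - 2 * e) * \<beta> + e * (4 * \<beta>)"
      using r N by linarith
    then have "(?A + 2 * e) * \<bar>?w\<bar> \<le> (?A + 2 * e) * \<beta>"
      using pos by (simp only: abs_mult abs_of_pos) (simp add: algebra_simps)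
    then show ?thesis using pos by (rule mult_left_le_imp_le)
  qed
qed

section \<open>Energy decay\<close>

text \<open>
  The proof tests the scheme with the increment \<open>w - v\<close>. Adjointness cancels the mixed terms of the old
  and the new grid function, and the two contributions \<open>\<plusminus> f(v) (w - v)\<close> cancel at every grid point, leaving
  at most \<open>- (1/\<tau> + \<kappa>/2) (w - v)\<^sup>2\<close>.
\<close>

lemma ESS1_step_energy:
  assumes M: "M > 0" and \<tau>: "0 < \<tau>" and "0 \<le> \<kappa>"
    and step: "ESS1_step M \<epsilon> f \<kappa> \<tau> v w" "v \<in> grid_functions M" "w \<in> grid_functions M"
    and F: "\<And>i j. i < M \<Longrightarrow> j < M \<Longrightarrow>
      F (w $$ (i, j)) - F (v $$ (i, j))
        \<le> - f (v $$ (i, j)) * (w $$ (i, j) - v $$ (i, j)) + \<kappa> / 2 * (w $$ (i, j) - v $$ (i, j))\<^sup>2"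
  shows "discrete_energy M \<epsilon> F w \<le> discrete_energy M \<epsilon> F v"
proof -
  let ?h = "(mesh_size M)\<^sup>2"
  let ?d = "\<lambda>i j. w $$ (i, j) - v $$ (i, j)"
  let ?L = "\<lambda>i j. Delta_a M v $$ (i, j) + Delta_b M w $$ (i, j)"
  have pot: "grid_inner M (map_mat F w) (grid_one M) - grid_inner M (map_mat F v) (grid_one M)
      = ?h * (\<Sum>i<M. \<Sum>j<M. F (w $$ (i, j)) - F (v $$ (i, j)))"
    using step(2,3) by (simp add: grid_inner_def grid_one_def sum_subtractf right_diff_distrib)
  have "?h * (\<Sum>i<M. \<Sum>j<M. ?L i j * ?d i j)
      = grid_inner M (Delta_a M v) w - grid_inner M (Delta_a M v) v
        + grid_inner M (Delta_b M w) w - grid_inner M (Delta_b M w) v"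
    by (simp add: grid_inner_def sum_subtractf sum.distrib algebra_simps)
  also have "\<dots> = grid_inner M (Delta_a M w) w - grid_inner M (Delta_a M v) v"
    using Delta_adjoint[OF step(2,3)] Delta_adjoint[OF step(3,3)]
    by (simp add: grid_inner_commute[of M "Delta_b M w"])
  finally have grad: "?h * (\<Sum>i<M. \<Sum>j<M. ?L i j * ?d i j)
      = ((grid_pair_norm M (grid_gradient M v))\<^sup>2 - (grid_pair_norm M (grid_gradient M w))\<^sup>2) / 2"
    by (simp add: grid_gradient_norm_sq M step)
  have "discrete_energy M \<epsilon> F w - discrete_energy M \<epsilon> F v
      = ?h * (\<Sum>i<M. \<Sum>j<M. F (w $$ (i, j)) - F (v $$ (i, j)))
        - \<epsilon>\<^sup>2 * (?h * (\<Sum>i<M. \<Sum>j<M. ?L i j * ?d i j))"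
    unfolding grad pot[symmetric] discrete_energy_def
    by (simp add: algebra_simps diff_divide_distrib)
  also have "\<dots> = ?h * (\<Sum>i<M. \<Sum>j<M. F (w $$ (i, j)) - F (v $$ (i, j)) - \<epsilon>\<^sup>2 * (?L i j * ?d i j))"
    by (simp only: sum_subtractf right_diff_distrib sum_distrib_left
        mult.left_commute[of "\<epsilon>\<^sup>2" ?h])
  also have "\<dots> \<le> 0"
  proof (intro mult_nonneg_nonpos sum_nonpos)
    fix i j assume "i \<in> {..<M}" "j \<in> {..<M}"
    then have ij: "i < M" "j < M" by auto
    have "\<epsilon>\<^sup>2 * ?L i j = (1 / \<tau> + \<kappa>) * ?d i j - f (v $$ (i, j))"
      using ESS1_step_index[OF step ij] by linarith
    then have "\<epsilon>\<^sup>2 * (?L i j * ?d i j) = ((1 / \<tau> + \<kappa>) * ?d i j - f (v $$ (i, j))) * ?d i j"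
      by (simp only: mult.assoc[symmetric])
    then have "\<epsilon>\<^sup>2 * (?L i j * ?d i j) = (1 / \<tau> + \<kappa>) * (?d i j)\<^sup>2 - f (v $$ (i, j)) * ?d i j"
      by (simp only: left_diff_distrib power2_eq_square mult.assoc)
    moreover have "0 \<le> (1 / \<tau> + \<kappa> / 2) * (?d i j)\<^sup>2"
      using \<tau> \<open>0 \<le> \<kappa>\<close> by (intro mult_nonneg_nonneg) auto
    ultimately show "F (w $$ (i, j)) - F (v $$ (i, j)) - \<epsilon>\<^sup>2 * (?L i j * ?d i j) \<le> 0"
      using F[OF ij] by (simp add: algebra_simps)
  qed simp
  finally show ?thesis by simp
qed

lemma abs_le_grid_sup_norm:
  assumes "i < M" "j < M"
  shows "\<bar>v $$ (i, j)\<bar> \<le> grid_sup_norm M v"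
  unfolding grid_sup_norm_def using assms by (intro Max_ge) force+

theorem theorem3p5:
  fixes M :: nat and \<epsilon> \<beta> \<kappa> \<tau> T :: real
    and I :: "real set" and f f' F :: "real \<Rightarrow> real"
    and u :: "nat \<Rightarrow> real mat"
  assumes "M > 0" and "\<epsilon> > 0" and "T > 0" and "\<beta> > 0"
    and "is_interval I" and "{- \<beta>..\<beta>} \<subseteq> I"
    and "C1_on_interval (- \<beta>) \<beta> f f'"
    and "f \<beta> \<le> 0" and "0 \<le> f (- \<beta>)"
    and "\<And>x. x \<in> I \<Longrightarrow> (F has_real_derivative - f x) (at x within I)"
    and "\<kappa> \<ge> C_norm (- \<beta>) \<beta> f'"
    and "0 < \<tau>" and "\<tau> \<le> (mesh_size M)\<^sup>2 / (2 * \<epsilon>\<^sup>2)"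
    and "grid_sup_norm M (u 0) \<le> \<beta>"
    and "ESS1_solution M \<epsilon> f \<kappa> \<tau> (nat \<lfloor>T / \<tau>\<rfloor>) u"
  shows "\<forall>n < nat \<lfloor>T / \<tau>\<rfloor>. discrete_energy M \<epsilon> F (u (n + 1)) \<le> discrete_energy M \<epsilon> F (u n)"
proof (intro allI impI)
  let ?N = "nat \<lfloor>T / \<tau>\<rfloor>"
  have grid: "u n \<in> grid_functions M" if "n \<le> ?N" for n
    using assms(15) that by (simp add: ESS1_solution_def)
  have step: "ESS1_step M \<epsilon> f \<kappa> \<tau> (u n) (u (n + 1))" if "n < ?N" for n
    using assms(15) that by (simp add: ESS1_solution_def)
  have bound: "\<bar>u n $$ (i, j)\<bar> \<le> \<beta>" if "n \<le> ?N" "i < M" "j < M" for n i j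
    using that
  proof (induction n arbitrary: i j)
    case 0
    then show ?case using abs_le_grid_sup_norm[of i M j "u 0"] assms(14) by linarith
  next
    case (Suc n)
    then have "\<bar>u n $$ (k, l)\<bar> \<le> \<beta>" if "k < M" "l < M" for k l using that by simp
    then show ?case
      using ESS1_step_maximum_principle[OF assms(1,2,12,13,7,11,8,9), of "u n" "u (Suc n)" i j]
        step[of n] grid[of n] grid[of "Suc n"] Suc.prems by simp
  qed
  have "0 \<le> \<kappa>"
    using C1_abs_derivative_le_C_norm[OF assms(7), of 0] assms(4,11) by auto
  have F: "(F has_real_derivative - f x) (at x within {- \<beta>..\<beta>})" if "x \<in> {- \<beta>..\<beta>}" for x
    using assms(6,10) that by (blast intro: DERIV_subset)
  fix n assume n: "n < ?N"
  show "discrete_energy M \<epsilon> F (u (n + 1)) \<le> discrete_energy M \<epsilon> F (u n)"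
  proof (rule ESS1_step_energy[OF assms(1,12) \<open>0 \<le> \<kappa>\<close> step[OF n]])
    fix i j assume ij: "i < M" "j < M"
    show "F (u (n + 1) $$ (i, j)) - F (u n $$ (i, j))
        \<le> - f (u n $$ (i, j)) * (u (n + 1) $$ (i, j) - u n $$ (i, j))
          + \<kappa> / 2 * (u (n + 1) $$ (i, j) - u n $$ (i, j))\<^sup>2"
      using bound[of n i j] bound[of "n + 1" i j] n ij
      by (intro potential_increment_le[OF assms(7,11) F]) auto
  qed (use n grid in auto)
qed

end
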